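(* Let $\mathbf{Z}=(\mathbf{L},A,Y)\sim P$, let $\theta(a)=\int_{\mathcal{L}}\mu(\mathbf{l},a)\,dP(\mathbf{l})$ and $\psi=\int_{\mathcal{A}}\theta(a)\varpi(a)\,da$. For fixed functions $\overline\pi(a\mid\mathbf{l})>0$ and $\overline\mu(\mathbf{l},a)$ define $$\xi(\mathbf{Z};\overline\pi,\overline\mu)=\frac{Y-\overline\mu(\mathbf{L},A)}{\overline\pi(A\mid\mathbf{L})}\int_{\mathcal{L}}\overline\pi(A\mid\mathbf{l})\,dP(\mathbf{l})+\int_{\mathcal{L}}\overline\mu(\mathbf{l},A)\,dP(\mathbf{l})$$ and $$\phi(\mathbf{Z};\overline\pi,\overline\mu,\psi)=\xi(\mathbf{Z};\overline\pi,\overline\mu)-\psi+\int_{\mathcal{A}}\Big\{\overline\mu(\mathbf{L},a)-\int_{\mathcal{L}}\overline\mu(\mathbf{l},a)\,dP(\mathbf{l})\Big\}\int_{\mathcal{L}}\overline\pi(a\mid\mathbf{l})\,dP(\mathbf{l})\,da .$$ If either $\overline\pi=\pi$ or $\overline\mu=\mu$ (not necessarily both), then $$\mathbb{E}\{\xi(\mathbf{Z};\overline\pi,\overline\mu)\mid A=a\}=\theta(a)\quad\text{for } a\in\mathcal{A},\qquad\text{and}\qquad \mathbb{E}\{\phi(\mathbf{Z};\overline\pi,\overline\mu,\psi)\}=0 .$$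
   Context: $\mathbf{Z}=(\mathbf{L},A,Y)$ has distribution $P$ and support $\mathcal{Z}=\mathcal{L}\times\mathcal{A}\times\mathcal{Y}$, where $\mathbf{L}$ is a covariate vector, $A$ a continuous real-valued treatment, $Y$ a real-valued outcome; $P$ has density $p(\mathbf{z})=p(y\mid\mathbf{l},a)p(a\mid\mathbf{l})p(\mathbf{l})$ with respect to a dominating measure (Lebesgue in $a$). $dP(\mathbf{l})$ denotes integration with respect to the marginal law of $\mathbf{L}$. $\mu(\mathbf{l},a)=\mathbb{E}(Y\mid\mathbf{L}=\mathbf{l},A=a)$; $\pi(a\mid\mathbf{l})$ is the conditional density of $A$ given $\mathbf{L}=\mathbf{l}$; $\varpi(a)=\int_{\mathcal{L}}\pi(a\mid\mathbf{l})\,dP(\mathbf{l})$ is the marginal density of $A$. Positivity is assumed: there is $\pi_{\min}>0$ with $\pi(a\mid\mathbf{l})\ge\pi_{\min}$ for all $a\in\mathcal{A}$, $\mathbf{l}\in\mathcal{L}$. All displayed integrals and expectations are assumed to be well defined and absolutely convergent. The conditional expectation given $A=a$ is the version computed from the conditional density $p(\mathbf{l}\mid a)=\pi(a\mid\mathbf{l})p(\mathbf{l})/\varpi(a)$. *)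

theory Defs
  imports "HOL-Probability.Probability"
begin

text \<open>
  The random vector \<open>(L, A, Y)\<close> takes values in \<open>\<L> \<times> \<A> \<times> \<Y>\<close> and has the density
  \<open>p(y | l, a) p(a | l) p(l)\<close>, written \<open>pY y l a * \<pi> a l * pL l\<close>, with respect to the product
  of \<open>\<nu>L\<close>, Lebesgue measure on \<open>\<A>\<close> and \<open>\<nu>Y\<close>.  Since \<open>pY\<close> and \<open>\<pi>\<close> are normalised
  for every value of the conditioning variables, \<open>pL\<close> is automatically the density of \<open>L\<close>.
  The conditional densities are fixed versions, because positivity and the regression function
  are required pointwise.
\<close>

locale continuous_treatment_model = prob_space M for M :: "'w measure" +
  fixes L :: "'w \<Rightarrow> real ^ 'd" and A :: "'w \<Rightarrow> real" and Y :: "'w \<Rightarrow> real"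
    and \<L> :: "(real ^ 'd) set" and \<A> :: "real set" and \<Y> :: "real set"
    and \<nu>L :: "(real ^ 'd) measure" and \<nu>Y :: "real measure"
    and pL :: "real ^ 'd \<Rightarrow> real"
    and \<pi> :: "real \<Rightarrow> real ^ 'd \<Rightarrow> real"
    and pY :: "real \<Rightarrow> real ^ 'd \<Rightarrow> real \<Rightarrow> real"
  assumes borel_supports: "\<L> \<in> sets borel" "\<A> \<in> sets borel" "\<Y> \<in> sets borel"
    and dominating_L: "sigma_finite_measure \<nu>L" "sets \<nu>L = sets (restrict_space borel \<L>)"
    and dominating_Y: "sigma_finite_measure \<nu>Y" "sets \<nu>Y = sets (restrict_space borel \<Y>)"
    and measurable_pL: "pL \<in> borel_measurable \<nu>L"
    and measurable_\<pi>:
      "(\<lambda>(l, a). \<pi> a l) \<in> borel_measurable (\<nu>L \<Otimes>\<^sub>M restrict_space lborel \<A>)"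
    and measurable_pY:
      "(\<lambda>(l, a, y). pY y l a)
         \<in> borel_measurable (\<nu>L \<Otimes>\<^sub>M (restrict_space lborel \<A> \<Otimes>\<^sub>M \<nu>Y))"
    and nonneg_pL: "\<And>l. l \<in> \<L> \<Longrightarrow> 0 \<le> pL l"
    and nonneg_pY: "\<And>l a y. l \<in> \<L> \<Longrightarrow> a \<in> \<A> \<Longrightarrow> y \<in> \<Y> \<Longrightarrow> 0 \<le> pY y l a"
    and conditional_density_A:
      "\<And>l. l \<in> \<L> \<Longrightarrow> (\<integral>\<^sup>+a. ennreal (\<pi> a l) \<partial>restrict_space lborel \<A>) = 1"
    and conditional_density_Y:
      "\<And>l a. l \<in> \<L> \<Longrightarrow> a \<in> \<A> \<Longrightarrow> (\<integral>\<^sup>+y. ennreal (pY y l a) \<partial>\<nu>Y) = 1"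
    and joint_density:
      "distributed M (\<nu>L \<Otimes>\<^sub>M (restrict_space lborel \<A> \<Otimes>\<^sub>M \<nu>Y)) (\<lambda>\<omega>. (L \<omega>, A \<omega>, Y \<omega>))
         (\<lambda>(l, a, y). ennreal (pY y l a * \<pi> a l * pL l))"
    and positivity: "\<exists>\<pi>_min>0. \<forall>a\<in>\<A>. \<forall>l\<in>\<L>. \<pi>_min \<le> \<pi> a l"

definition covariate_law ::
    "'w measure \<Rightarrow> ('w \<Rightarrow> real ^ 'd) \<Rightarrow> (real ^ 'd) set \<Rightarrow> (real ^ 'd) measure" where
  "covariate_law M L \<L> = distr M (restrict_space borel \<L>) L"

definition regression ::
    "real measure \<Rightarrow> (real \<Rightarrow> 'l \<Rightarrow> real \<Rightarrow> real) \<Rightarrow> 'l \<Rightarrow> real \<Rightarrow> real" where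
  "regression \<nu>Y pY l a = (\<integral>y. y * pY y l a \<partial>\<nu>Y)"

definition marginal_density :: "'l measure \<Rightarrow> (real \<Rightarrow> 'l \<Rightarrow> real) \<Rightarrow> real \<Rightarrow> real" where
  "marginal_density PL \<pi> a = (\<integral>l. \<pi> a l \<partial>PL)"

definition effect_curve :: "'l measure \<Rightarrow> ('l \<Rightarrow> real \<Rightarrow> real) \<Rightarrow> real \<Rightarrow> real" where
  "effect_curve PL \<mu> a = (\<integral>l. \<mu> l a \<partial>PL)"

definition mean_effect ::
    "'l measure \<Rightarrow> real set \<Rightarrow> (real \<Rightarrow> 'l \<Rightarrow> real) \<Rightarrow> ('l \<Rightarrow> real \<Rightarrow> real) \<Rightarrow> real" where
  "mean_effect PL \<A> \<pi> \<mu> =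
     (LINT a:\<A>|lborel. effect_curve PL \<mu> a * marginal_density PL \<pi> a)"

definition \<xi> ::
    "'l measure \<Rightarrow> (real \<Rightarrow> 'l \<Rightarrow> real) \<Rightarrow> ('l \<Rightarrow> real \<Rightarrow> real) \<Rightarrow> 'l \<times> real \<times> real \<Rightarrow> real" where
  "\<xi> PL \<pi>' \<mu>' = (\<lambda>(l, a, y).
     (y - \<mu>' l a) / \<pi>' a l * (\<integral>l'. \<pi>' a l' \<partial>PL) + (\<integral>l'. \<mu>' l' a \<partial>PL))"

definition \<phi> ::
    "'l measure \<Rightarrow> real set \<Rightarrow> (real \<Rightarrow> 'l \<Rightarrow> real) \<Rightarrow> ('l \<Rightarrow> real \<Rightarrow> real) \<Rightarrow> real
      \<Rightarrow> 'l \<times> real \<times> real \<Rightarrow> real" where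
  "\<phi> PL \<A> \<pi>' \<mu>' \<psi> = (\<lambda>(l, a, y).
     \<xi> PL \<pi>' \<mu>' (l, a, y) - \<psi> +
     (LINT t:\<A>|lborel. (\<mu>' l t - (\<integral>l'. \<mu>' l' t \<partial>PL)) * (\<integral>l'. \<pi>' t l' \<partial>PL)))"

text \<open>
  The density of \<open>(L, Y)\<close> given \<open>A = a\<close> with respect to \<open>\<nu>L \<Otimes>\<^sub>M \<nu>Y\<close>, namely
  \<open>p(y | l, a) p(l | a)\<close> with \<open>p(l | a) = \<pi>(a | l) p(l) / \<varpi>(a)\<close>; the argument \<open>w\<close> is the
  marginal density \<open>\<varpi>\<close> of the treatment.
\<close>

definition conditional_density ::
    "('l \<Rightarrow> real) \<Rightarrow> (real \<Rightarrow> 'l \<Rightarrow> real) \<Rightarrow> (real \<Rightarrow> 'l \<Rightarrow> real \<Rightarrow> real) \<Rightarrow> (real \<Rightarrow> real)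
      \<Rightarrow> real \<Rightarrow> 'l \<times> real \<Rightarrow> real" where
  "conditional_density pL \<pi> pY w a = (\<lambda>(l, y). pY y l a * (\<pi> a l * pL l / w a))"

definition conditional_expectation ::
    "'l measure \<Rightarrow> real measure \<Rightarrow> (real \<Rightarrow> 'l \<times> real \<Rightarrow> real) \<Rightarrow> ('l \<times> real \<times> real \<Rightarrow> real)
      \<Rightarrow> real \<Rightarrow> real" where
  "conditional_expectation \<nu>L \<nu>Y q f a =
     (\<integral>(l, y). f (l, a, y) * q a (l, y) \<partial>(\<nu>L \<Otimes>\<^sub>M \<nu>Y))"

end

theory Submission
  imports Defs
begin

text \<open>
  Averaging over \<open>y\<close> turns \<open>\<xi>\<close> into
  \<open>(\<mu> - \<mu>') / \<pi>' * \<integral> \<pi>' dP + \<integral> \<mu>' dP\<close>. Averaged against \<open>\<pi> dP\<close>, the first term vanishes when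
  \<open>\<mu>' = \<mu>\<close>; when \<open>\<pi>' = \<pi>\<close> the weights cancel and it corrects \<open>\<integral> \<mu>' dP\<close> to \<open>\<theta>\<close>. The last term of
  \<open>\<phi>\<close> is centred in \<open>l\<close> for every fixed treatment, so Fubini removes it from the expectation.
\<close>

text \<open>The density of the model is ordered as (l, a, y), while conditioning on the treatment
  calls for a outermost. Integrating out the last coordinate leaves a function \<open>F\<close> on
  the first two; Tonelli applied to the norm of \<open>f\<close> makes \<open>F\<close> integrable,
  so ordinary Fubini may swap the remaining pair.\<close>

lemma integral_triple_swap:
  fixes f :: "'a \<times> 'b \<times> 'c \<Rightarrow> real"
  assumes "sigma_finite_measure M1" "sigma_finite_measure M2" "sigma_finite_measure M3"
    and f: "integrable (M1 \<Otimes>\<^sub>M (M2 \<Otimes>\<^sub>M M3)) f"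
  shows "(\<integral>x. f x \<partial>(M1 \<Otimes>\<^sub>M (M2 \<Otimes>\<^sub>M M3))) = (\<integral>y. \<integral>x. \<integral>z. f (x, y, z) \<partial>M3 \<partial>M1 \<partial>M2)"
proof -
  interpret s1: sigma_finite_measure M1 by fact
  interpret s2: sigma_finite_measure M2 by fact
  interpret s3: sigma_finite_measure M3 by fact
  interpret p12: pair_sigma_finite M1 M2 ..
  interpret p23: pair_sigma_finite M2 M3 ..
  interpret p123: pair_sigma_finite M1 "M2 \<Otimes>\<^sub>M M3" ..
  define F where "F = (\<lambda>(x, y). \<integral>z. f (x, y, z) \<partial>M3)"
  have [measurable]: "f \<in> borel_measurable (M1 \<Otimes>\<^sub>M (M2 \<Otimes>\<^sub>M M3))"
    using f by (rule borel_measurable_integrable)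
  have [measurable]: "F \<in> borel_measurable (M1 \<Otimes>\<^sub>M M2)"
    unfolding F_def by measurable
  \<comment> \<open>Valid at every point: where the section is not integrable, the Bochner integral
    takes the default value 0.\<close>
  have bound: "ennreal (norm (F (x, y))) \<le> (\<integral>\<^sup>+z. norm (f (x, y, z)) \<partial>M3)" for x y
    using integral_norm_bound_ennreal[of M3 "\<lambda>z. f (x, y, z)"]
    by (cases "integrable M3 (\<lambda>z. f (x, y, z))") (auto simp: F_def not_integrable_integral_eq)
  have "(\<integral>\<^sup>+p. norm (F p) \<partial>(M1 \<Otimes>\<^sub>M M2)) = (\<integral>\<^sup>+x. \<integral>\<^sup>+y. norm (F (x, y)) \<partial>M2 \<partial>M1)"
    by (rule s2.nn_integral_fst[symmetric]) measurable
  also have "\<dots> \<le> (\<integral>\<^sup>+x. \<integral>\<^sup>+y. \<integral>\<^sup>+z. norm (f (x, y, z)) \<partial>M3 \<partial>M2 \<partial>M1)"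
    by (intro nn_integral_mono bound)
  also have "\<dots> = (\<integral>\<^sup>+x. \<integral>\<^sup>+p. norm (f (x, p)) \<partial>(M2 \<Otimes>\<^sub>M M3) \<partial>M1)"
  proof (rule nn_integral_cong)
    fix x assume [measurable]: "x \<in> space M1"
    show "(\<integral>\<^sup>+y. \<integral>\<^sup>+z. norm (f (x, y, z)) \<partial>M3 \<partial>M2) = (\<integral>\<^sup>+p. norm (f (x, p)) \<partial>(M2 \<Otimes>\<^sub>M M3))"
      by (rule s3.nn_integral_fst) measurable
  qed
  also have "\<dots> = (\<integral>\<^sup>+p. norm (f p) \<partial>(M1 \<Otimes>\<^sub>M (M2 \<Otimes>\<^sub>M M3)))"
    by (rule p23.P.nn_integral_fst) measurable
  also have "\<dots> < \<infinity>"
    using f by (simp add: integrable_iff_bounded)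
  finally have F: "integrable (M1 \<Otimes>\<^sub>M M2) F"
    by (intro integrableI_bounded) auto
  have "(\<integral>x. f x \<partial>(M1 \<Otimes>\<^sub>M (M2 \<Otimes>\<^sub>M M3))) = (\<integral>x. \<integral>p. f (x, p) \<partial>(M2 \<Otimes>\<^sub>M M3) \<partial>M1)"
    by (rule p123.integral_fst'[OF f, symmetric])
  also have "\<dots> = (\<integral>x. \<integral>y. F (x, y) \<partial>M2 \<partial>M1)"
  proof (rule integral_cong_AE)
    \<comment> \<open>The section of \<open>f\<close> at x is integrable only for almost every x, so
      the inner Fubini step is available only there.\<close>
    show "AE x in M1. (\<integral>p. f (x, p) \<partial>(M2 \<Otimes>\<^sub>M M3)) = (\<integral>y. F (x, y) \<partial>M2)"
      using p123.AE_integrable_fst'[OF f]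
    proof eventually_elim
      case (elim x)
      then show ?case using p23.integral_fst'[of "\<lambda>p. f (x, p)"] by (simp add: F_def)
    qed
  qed measurable
  also have "\<dots> = (\<integral>y. \<integral>x. F (x, y) \<partial>M1 \<partial>M2)"
    using F p12.Fubini_integral[of "\<lambda>x y. F (x, y)"] by simp
  finally show ?thesis by (simp add: F_def)
qed

context continuous_treatment_model
begin

section \<open>Base measures and sections of the densities\<close>

abbreviation "\<nu>A \<equiv> restrict_space lborel \<A>"

lemma space_\<nu>L: "space \<nu>L = \<L>"
  using sets_eq_imp_space_eq[OF dominating_L(2)] by (simp add: space_restrict_space)

lemma space_\<nu>Y: "space \<nu>Y = \<Y>"
  using sets_eq_imp_space_eq[OF dominating_Y(2)] by (simp add: space_restrict_space)

lemma space_\<nu>A: "space \<nu>A = \<A>"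
  by (simp add: space_restrict_space)

lemma sigma_finite_\<nu>A: "sigma_finite_measure \<nu>A"
  using borel_supports by (intro sigma_finite_measure_restrict_space) (auto intro: sigma_finite_lborel)

lemma nonneg_\<pi>: "l \<in> \<L> \<Longrightarrow> a \<in> \<A> \<Longrightarrow> 0 \<le> \<pi> a l"
  using positivity by force

lemma measurable_pY_section:
  "l \<in> \<L> \<Longrightarrow> a \<in> \<A> \<Longrightarrow> (\<lambda>y. pY y l a) \<in> borel_measurable \<nu>Y"
proof -
  assume "l \<in> \<L>" "a \<in> \<A>"
  then have "(\<lambda>y. (l, a, y)) \<in> \<nu>Y \<rightarrow>\<^sub>M \<nu>L \<Otimes>\<^sub>M (\<nu>A \<Otimes>\<^sub>M \<nu>Y)"
    by (intro measurable_Pair measurable_const measurable_ident_sets) (auto simp: space_\<nu>L space_\<nu>A)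
  from measurable_compose[OF this measurable_pY] show ?thesis by simp
qed

lemma measurable_\<pi>_section:
  "l \<in> \<L> \<Longrightarrow> (\<lambda>a. \<pi> a l) \<in> borel_measurable \<nu>A"
  using measurable_compose[OF measurable_Pair1' measurable_\<pi>] by (simp add: space_\<nu>L)

text \<open>Moves the normalisation from the nonnegative to the Bochner integral, where signed
  integrands such as \<xi> can be split by linearity.\<close>

lemma has_bochner_integral_pY:
  assumes "l \<in> \<L>" "a \<in> \<A>"
  shows "has_bochner_integral \<nu>Y (\<lambda>y. pY y l a) 1"
  using assms conditional_density_Y[OF assms] measurable_pY_section
  by (intro has_bochner_integral_nn_integral) (auto simp: nonneg_pY space_\<nu>Y)

text \<open>Marginalising the joint density over (a, y) removes \<open>pY\<close> and then
  \<open>\<pi>\<close>, each of which has mass one at every conditioning value, and leaves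
  \<open>pL\<close>.\<close>

lemma covariate_law_eq_density: "covariate_law M L \<L> = density \<nu>L (\<lambda>l. ennreal (pL l))"
proof -
  interpret sL: sigma_finite_measure \<nu>L by (rule dominating_L)
  interpret sY: sigma_finite_measure \<nu>Y by (rule dominating_Y)
  interpret sA: sigma_finite_measure \<nu>A by (rule sigma_finite_\<nu>A)
  interpret pAY: pair_sigma_finite \<nu>A \<nu>Y ..
  note AY = pAY.P.sigma_finite_measure_axioms
  note [measurable] = measurable_pY measurable_\<pi> measurable_pL
  let ?f = "\<lambda>(l, a, y). ennreal (pY y l a * \<pi> a l * pL l)"
  have "distributed M \<nu>L L (\<lambda>l. \<integral>\<^sup>+p. ?f (l, p) \<partial>(\<nu>A \<Otimes>\<^sub>M \<nu>Y))"
    by (rule distr_marginal1[OF dominating_L(1) AY joint_density])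
  then have "distr M \<nu>L L = density \<nu>L (\<lambda>l. \<integral>\<^sup>+p. ?f (l, p) \<partial>(\<nu>A \<Otimes>\<^sub>M \<nu>Y))"
    by (rule distributed_distr_eq_density)
  also have "\<dots> = density \<nu>L (\<lambda>l. ennreal (pL l))"
  proof (rule density_cong)
    show "(\<lambda>l. \<integral>\<^sup>+p. ?f (l, p) \<partial>(\<nu>A \<Otimes>\<^sub>M \<nu>Y)) \<in> borel_measurable \<nu>L"
      using distr_marginal1[OF dominating_L(1) AY joint_density]
      by (intro distributed_borel_measurable)
    show "AE l in \<nu>L. (\<integral>\<^sup>+p. ?f (l, p) \<partial>(\<nu>A \<Otimes>\<^sub>M \<nu>Y)) = ennreal (pL l)"
    proof (rule AE_I2)
      fix l assume l: "l \<in> space \<nu>L"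
      then have l': "l \<in> \<L>" by (simp add: space_\<nu>L)
      have m: "(\<lambda>p. ?f (l, p)) \<in> borel_measurable (\<nu>A \<Otimes>\<^sub>M \<nu>Y)"
        using measurable_compose[OF measurable_Pair1'[OF l] distributed_borel_measurable[OF joint_density]]
        by simp
      have "(\<integral>\<^sup>+p. ?f (l, p) \<partial>(\<nu>A \<Otimes>\<^sub>M \<nu>Y)) = (\<integral>\<^sup>+a. \<integral>\<^sup>+y. ?f (l, a, y) \<partial>\<nu>Y \<partial>\<nu>A)"
        by (rule sY.nn_integral_fst[symmetric, OF m])
      also have "\<dots> = (\<integral>\<^sup>+a. ennreal (\<pi> a l) * ennreal (pL l) \<partial>\<nu>A)"
      proof (rule nn_integral_cong)
        fix a assume "a \<in> space \<nu>A"
        then have a: "a \<in> \<A>" by (simp only: space_\<nu>A)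
        \<comment> \<open>Nonnegativity of the three factors lets \<open>ennreal\<close> be
          distributed over their product, so that the part free of y can be pulled out.\<close>
        have "(\<integral>\<^sup>+y. ?f (l, a, y) \<partial>\<nu>Y)
            = (\<integral>\<^sup>+y. ennreal (pY y l a) * (ennreal (\<pi> a l) * ennreal (pL l)) \<partial>\<nu>Y)"
          using l' a by (intro nn_integral_cong)
            (simp add: space_\<nu>Y ennreal_mult nonneg_pY nonneg_pL nonneg_\<pi> mult.assoc)
        also have "\<dots> = (\<integral>\<^sup>+y. ennreal (pY y l a) \<partial>\<nu>Y) * (ennreal (\<pi> a l) * ennreal (pL l))"
          using measurable_pY_section[OF l' a] by (intro nn_integral_multc) auto
        finally show "(\<integral>\<^sup>+y. ?f (l, a, y) \<partial>\<nu>Y) = ennreal (\<pi> a l) * ennreal (pL l)"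
          using conditional_density_Y[OF l' a] by simp
      qed
      also have "\<dots> = (\<integral>\<^sup>+a. ennreal (\<pi> a l) \<partial>\<nu>A) * ennreal (pL l)"
        using measurable_\<pi>_section[OF l'] by (intro nn_integral_multc) auto
      finally show "(\<integral>\<^sup>+p. ?f (l, p) \<partial>(\<nu>A \<Otimes>\<^sub>M \<nu>Y)) = ennreal (pL l)"
        using conditional_density_A[OF l'] by simp
    qed
  qed measurable
  finally show ?thesis
    unfolding covariate_law_def by (simp add: dominating_L(2) cong: distr_cong)
qed

section \<open>Integration against the law of the covariates\<close>

lemma random_variable_L: "L \<in> M \<rightarrow>\<^sub>M \<nu>L"
  using measurable_compose[OF distributed_measurable[OF joint_density] measurable_fst] by simp

text \<open>\<open>distr\<close> sees its target measure only through the sigma-algebra, and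
  \<open>\<nu>L\<close> carries the Borel sets of the support.\<close>

lemma covariate_law_eq_distr: "covariate_law M L \<L> = distr M \<nu>L L"
  unfolding covariate_law_def by (rule distr_cong) (simp_all add: dominating_L(2))

lemma sets_covariate_law: "sets (covariate_law M L \<L>) = sets \<nu>L"
  by (simp add: covariate_law_eq_distr)

lemma space_covariate_law: "space (covariate_law M L \<L>) = \<L>"
  by (simp add: covariate_law_eq_distr space_\<nu>L)

lemma prob_space_covariate_law: "prob_space (covariate_law M L \<L>)"
  unfolding covariate_law_eq_distr by (rule prob_space_distr[OF random_variable_L])

text \<open>Links the integrals dP(l) of the statement to integrals against \<open>\<nu>L\<close>,
  in which the conditional density is written. If one side is not integrable, neither is the other,
  and both default to 0.\<close>

lemma integral_covariate_law:
  assumes "g \<in> borel_measurable \<nu>L"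
  shows "(\<integral>l. g l \<partial>covariate_law M L \<L>) = (\<integral>l. g l * pL l \<partial>\<nu>L)"
  unfolding covariate_law_eq_density using assms measurable_pL
  by (subst integral_real_density) (auto simp: space_\<nu>L nonneg_pL mult.commute)

text \<open>The uniform lower bound on \<open>\<pi>\<close> survives averaging under a probability
  measure. This justifies cancelling the normaliser of p(l | a).\<close>

lemma marginal_density_pos:
  assumes a: "a \<in> \<A>" and int: "integrable (covariate_law M L \<L>) (\<lambda>l. \<pi> a l)"
  shows "0 < marginal_density (covariate_law M L \<L>) \<pi> a"
proof -
  interpret PL: prob_space "covariate_law M L \<L>" by (rule prob_space_covariate_law)
  obtain c where c: "0 < c" "\<And>l. l \<in> \<L> \<Longrightarrow> c \<le> \<pi> a l" using positivity a by blast
  have "c \<le> (\<integral>l. \<pi> a l \<partial>covariate_law M L \<L>)"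
    using c int by (intro PL.integral_ge_const AE_I2) (auto simp: space_covariate_law)
  with c(1) show ?thesis by (simp add: marginal_density_def)
qed

lemma integral_\<xi>_outcome:
  assumes l: "l \<in> \<L>" and a: "a \<in> \<A>" and int: "integrable \<nu>Y (\<lambda>y. y * pY y l a)"
  shows "(\<integral>y. \<xi> PL \<pi>' \<mu>' (l, a, y) * pY y l a \<partial>\<nu>Y) =
    (regression \<nu>Y pY l a - \<mu>' l a) / \<pi>' a l * (\<integral>l'. \<pi>' a l' \<partial>PL) + (\<integral>l'. \<mu>' l' a \<partial>PL)"
proof -
  have p: "integrable \<nu>Y (\<lambda>y. pY y l a)" "(\<integral>y. pY y l a \<partial>\<nu>Y) = 1"
    using has_bochner_integral_pY[OF l a] by (auto simp: has_bochner_integral_iff)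
  \<comment> \<open>At fixed l and a, \<open>\<xi>\<close> is affine in y with slope
    \<open>c\<close> and intercept \<open>m - c * \<mu>' l a\<close>. Hence only the mass and the
    mean of the outcome density enter.\<close>
  define c where "c = (\<integral>l'. \<pi>' a l' \<partial>PL) / \<pi>' a l"
  define m where "m = (\<integral>l'. \<mu>' l' a \<partial>PL)"
  have "(\<integral>y. \<xi> PL \<pi>' \<mu>' (l, a, y) * pY y l a \<partial>\<nu>Y)
      = (\<integral>y. c * (y * pY y l a) + (m - c * \<mu>' l a) * pY y l a \<partial>\<nu>Y)"
    by (intro Bochner_Integration.integral_cong) (auto simp: \<xi>_def c_def m_def divide_inverse algebra_simps)
  also have "\<dots> = c * regression \<nu>Y pY l a + (m - c * \<mu>' l a)"
    using p int by (simp add: regression_def)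
  finally show ?thesis by (simp add: c_def m_def divide_inverse algebra_simps)
qed

end

theorem mainTheorem2:
  fixes M :: "'w measure"
    and L :: "'w \<Rightarrow> real ^ 'd" and A :: "'w \<Rightarrow> real" and Y :: "'w \<Rightarrow> real"
    and \<L> :: "(real ^ 'd) set" and \<A> :: "real set" and \<Y> :: "real set"
    and \<nu>L PL :: "(real ^ 'd) measure" and \<nu>Y :: "real measure"
    and pL :: "real ^ 'd \<Rightarrow> real"
    and \<pi> \<pi>' :: "real \<Rightarrow> real ^ 'd \<Rightarrow> real"
    and pY :: "real \<Rightarrow> real ^ 'd \<Rightarrow> real \<Rightarrow> real"
    and \<mu> \<mu>' :: "real ^ 'd \<Rightarrow> real \<Rightarrow> real"
    and \<theta> w :: "real \<Rightarrow> real" and \<psi> :: real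
    and q :: "real \<Rightarrow> (real ^ 'd) \<times> real \<Rightarrow> real"
  assumes model: "continuous_treatment_model M L A Y \<L> \<A> \<Y> \<nu>L \<nu>Y pL \<pi> pY"
    and PL: "PL = covariate_law M L \<L>"
    and \<mu>: "\<mu> = regression \<nu>Y pY"
    and w: "w = marginal_density PL \<pi>"
    and \<theta>: "\<theta> = effect_curve PL \<mu>"
    and \<psi>: "\<psi> = mean_effect PL \<A> \<pi> \<mu>"
    and q: "q = conditional_density pL \<pi> pY w"
    and measurable_\<pi>':
      "(\<lambda>(l, a). \<pi>' a l) \<in> borel_measurable (PL \<Otimes>\<^sub>M restrict_space lborel \<A>)"
    and measurable_\<mu>':
      "(\<lambda>(l, a). \<mu>' l a) \<in> borel_measurable (PL \<Otimes>\<^sub>M restrict_space lborel \<A>)"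
    and positive_\<pi>': "\<forall>a\<in>\<A>. \<forall>l\<in>\<L>. 0 < \<pi>' a l"
    and integrable_\<mu>: "\<forall>l\<in>\<L>. \<forall>a\<in>\<A>. integrable \<nu>Y (\<lambda>y. y * pY y l a)"
    and integrable_w: "\<forall>a\<in>\<A>. integrable PL (\<lambda>l. \<pi> a l)"
    and integrable_\<theta>: "\<forall>a\<in>\<A>. integrable PL (\<lambda>l. \<mu> l a)"
    and integrable_\<psi>: "set_integrable lborel \<A> (\<lambda>a. \<theta> a * w a)"
    and integrable_\<pi>': "\<forall>a\<in>\<A>. integrable PL (\<lambda>l. \<pi>' a l)"
    and integrable_\<mu>': "\<forall>a\<in>\<A>. integrable PL (\<lambda>l. \<mu>' l a)"
    and integrable_correction:
      "integrable (PL \<Otimes>\<^sub>M restrict_space lborel \<A>)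
         (\<lambda>(l, a). (\<mu>' l a - (\<integral>l'. \<mu>' l' a \<partial>PL)) * (\<integral>l'. \<pi>' a l' \<partial>PL))"
    and integrable_\<xi>:
      "\<forall>a\<in>\<A>. integrable (\<nu>L \<Otimes>\<^sub>M \<nu>Y) (\<lambda>(l, y). \<xi> PL \<pi>' \<mu>' (l, a, y) * q a (l, y))"
    and integrable_\<phi>: "integrable M (\<lambda>\<omega>. \<phi> PL \<A> \<pi>' \<mu>' \<psi> (L \<omega>, A \<omega>, Y \<omega>))"
    and correct_nuisance:
      "(\<forall>a\<in>\<A>. \<forall>l\<in>\<L>. \<pi>' a l = \<pi> a l) \<or> (\<forall>l\<in>\<L>. \<forall>a\<in>\<A>. \<mu>' l a = \<mu> l a)"
  shows "(\<forall>a\<in>\<A>. conditional_expectation \<nu>L \<nu>Y q (\<xi> PL \<pi>' \<mu>') a = \<theta> a) \<and>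
         prob_space.expectation M (\<lambda>\<omega>. \<phi> PL \<A> \<pi>' \<mu>' \<psi> (L \<omega>, A \<omega>, Y \<omega>)) = 0"
proof -
  interpret continuous_treatment_model M L A Y \<L> \<A> \<Y> \<nu>L \<nu>Y pL \<pi> pY by (rule model)
  interpret sL: sigma_finite_measure \<nu>L by (rule dominating_L)
  interpret sY: sigma_finite_measure \<nu>Y by (rule dominating_Y)
  interpret sA: sigma_finite_measure \<nu>A by (rule sigma_finite_\<nu>A)
  interpret PL: prob_space PL unfolding PL by (rule prob_space_covariate_law)
  interpret pLY: pair_sigma_finite \<nu>L \<nu>Y ..
  interpret pPA: pair_sigma_finite PL \<nu>A ..
  have space_PL: "space PL = \<L>" by (simp add: PL space_covariate_law)
  have sets_PL: "sets PL = sets \<nu>L" by (simp add: PL sets_covariate_law)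
  have PLd: "(\<integral>l. g l \<partial>PL) = (\<integral>l. g l * pL l \<partial>\<nu>L)" if "g \<in> borel_measurable \<nu>L" for g :: "_ \<Rightarrow> real"
    using integral_covariate_law[OF that] by (simp add: PL)
  have cong_PL: "(\<integral>l. f l \<partial>PL) = (\<integral>l. g l \<partial>PL)" if "\<And>l. l \<in> \<L> \<Longrightarrow> f l = g l"
    for f g :: "real ^ 'd \<Rightarrow> real"
    using that by (intro Bochner_Integration.integral_cong) (auto simp: space_PL)
  have w_pos: "0 < w a" if "a \<in> \<A>" for a
    using marginal_density_pos[OF that] integrable_w that by (simp add: w PL)
  define m' where "m' a = (\<integral>l. \<mu>' l a \<partial>PL)" for a
  define W' where "W' a = (\<integral>l. \<pi>' a l \<partial>PL)" for a
  \<comment> \<open>The mean of \<xi> given L = l and A = a.\<close>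
  define G where "G l a = (\<mu> l a - \<mu>' l a) / \<pi>' a l * W' a + m' a" for l a

  \<comment> \<open>The free factor \<open>c\<close> serves two uses:
    \<open>\<pi> a l * pL l / w a\<close> for the conditional density and
    \<open>\<pi> a l * pL l\<close> for the joint one.\<close>
  have inner: "(\<integral>y. \<xi> PL \<pi>' \<mu>' (l, a, y) * (pY y l a * c) \<partial>\<nu>Y) = G l a * c"
    if "l \<in> \<L>" "a \<in> \<A>" for l a c
    using integral_\<xi>_outcome[OF that, of PL \<pi>' \<mu>'] integrable_\<mu> that
    by (simp add: G_def \<mu> m'_def W'_def mult.assoc[symmetric])
  have [measurable]: "(\<lambda>p. \<pi>' (snd p) (fst p)) \<in> borel_measurable (\<nu>L \<Otimes>\<^sub>M \<nu>A)"
      "(\<lambda>p. \<mu>' (fst p) (snd p)) \<in> borel_measurable (\<nu>L \<Otimes>\<^sub>M \<nu>A)"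
    using measurable_\<pi>' measurable_\<mu>' sets_pair_measure_cong[OF sets_PL refl, of \<nu>A]
    by (simp_all add: case_prod_beta cong: measurable_cong_sets)

  \<comment> \<open>This identity carries the double robustness. Dividing it by \<open>w a\<close>
    gives the conditional claim; integrating it over a gives \<psi>.\<close>
  have \<theta>w: "(\<integral>l. G l a * \<pi> a l \<partial>PL) = \<theta> a * w a" if a: "a \<in> \<A>" for a
    using correct_nuisance
  proof
    assume eq: "\<forall>a\<in>\<A>. \<forall>l\<in>\<L>. \<pi>' a l = \<pi> a l"
    have W: "W' a = w a"
      unfolding W'_def w marginal_density_def using eq a by (intro cong_PL) auto
    \<comment> \<open>Positivity of \<open>\<pi>'\<close> cancels it against \<open>\<pi>\<close>,
      so the residual keeps only the factor \<open>w a\<close>, constant in l.\<close>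
    have "(\<integral>l. G l a * \<pi> a l \<partial>PL) = (\<integral>l. (\<mu> l a - \<mu>' l a) * w a + m' a * \<pi> a l \<partial>PL)"
      using eq a positive_\<pi>' by (intro cong_PL) (fastforce simp: G_def W field_simps)
    also have "\<dots> = (\<theta> a - m' a) * w a + m' a * w a"
      using a integrable_\<theta> integrable_\<mu>' integrable_w
      by (simp add: \<theta> effect_curve_def m'_def w marginal_density_def)
    finally show ?thesis by (simp add: algebra_simps)
  next
    assume eq: "\<forall>l\<in>\<L>. \<forall>a\<in>\<A>. \<mu>' l a = \<mu> l a"
    have m: "m' a = \<theta> a"
      unfolding m'_def \<theta> effect_curve_def using eq a by (intro cong_PL) auto
    \<comment> \<open>The residual is zero at every l, whatever the weight \<open>\<pi>'\<close> is,
      so \<open>G l a\<close> is the constant \<open>\<theta> a\<close>.\<close>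
    have "(\<integral>l. G l a * \<pi> a l \<partial>PL) = (\<integral>l. \<theta> a * \<pi> a l \<partial>PL)"
      using eq a by (intro cong_PL) (auto simp: G_def m)
    then show ?thesis by (simp add: w marginal_density_def)
  qed
  have measG: "(\<lambda>l. G l a * \<pi> a l) \<in> borel_measurable \<nu>L" if a: "a \<in> \<A>" for a
  proof -
    \<comment> \<open>Measurability in l at a fixed treatment is read off from the integrability
      hypotheses.\<close>
    have [measurable]: "(\<lambda>l. \<mu> l a) \<in> borel_measurable PL" "(\<lambda>l. \<mu>' l a) \<in> borel_measurable PL"
        "(\<lambda>l. \<pi>' a l) \<in> borel_measurable PL" "(\<lambda>l. \<pi> a l) \<in> borel_measurable PL"
      using a integrable_\<theta> integrable_\<mu>' integrable_\<pi>' integrable_w by auto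
    have "(\<lambda>l. G l a * \<pi> a l) \<in> borel_measurable PL" unfolding G_def by measurable
    then show ?thesis by (simp add: measurable_cong_sets[OF sets_PL refl])
  qed
  have G\<nu>L: "(\<integral>l. G l a * (\<pi> a l * pL l) \<partial>\<nu>L) = \<theta> a * w a" if a: "a \<in> \<A>" for a
    using PLd[OF measG[OF a]] \<theta>w[OF a] by (simp add: mult.assoc)

  have part1: "conditional_expectation \<nu>L \<nu>Y q (\<xi> PL \<pi>' \<mu>') a = \<theta> a" if a: "a \<in> \<A>" for a
  proof -
    have "conditional_expectation \<nu>L \<nu>Y q (\<xi> PL \<pi>' \<mu>') a
        = (\<integral>l. \<integral>y. \<xi> PL \<pi>' \<mu>' (l, a, y) * (pY y l a * (\<pi> a l * pL l / w a)) \<partial>\<nu>Y \<partial>\<nu>L)"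
      using pLY.integral_fst'[OF integrable_\<xi>[rule_format, OF a]]
      by (simp add: conditional_expectation_def q conditional_density_def)
    also have "\<dots> = (\<integral>l. G l a * (\<pi> a l * pL l / w a) \<partial>\<nu>L)"
      by (intro Bochner_Integration.integral_cong) (auto simp: space_\<nu>L inner a)
    \<comment> \<open>The normaliser \<open>w a\<close> does not depend on l; being positive, it
      cancels against the factor in \<open>\<theta> a * w a\<close>.\<close>
    also have "\<dots> = (\<integral>l. G l a * (\<pi> a l * pL l) \<partial>\<nu>L) / w a"
      by simp
    finally show ?thesis
      using G\<nu>L[OF a] w_pos[OF a] by simp
  qed

  \<comment> \<open>Mean zero of the correction term\<close>
  have L_PL: "distr M PL L = PL"
    by (simp add: PL covariate_law_eq_distr cong: distr_cong)
  have L_meas: "L \<in> M \<rightarrow>\<^sub>M PL"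
    using random_variable_L by (simp add: measurable_cong_sets[OF refl sets_PL])
  \<comment> \<open>The last term of \<phi>, which depends on the observation through the covariates
    alone.\<close>
  define C where "C l = (\<integral>t. (\<mu>' l t - m' t) * W' t \<partial>\<nu>A)" for l
  have corr: "integrable (PL \<Otimes>\<^sub>M \<nu>A) (\<lambda>(l, a). (\<mu>' l a - m' a) * W' a)"
    using integrable_correction by (simp add: m'_def W'_def)
  have C: "integrable PL C"
    using pPA.integrable_fst'[OF corr] by (simp add: C_def[abs_def])
  have "(\<integral>l. C l \<partial>PL) = (\<integral>t. \<integral>l. (\<mu>' l t - m' t) * W' t \<partial>PL \<partial>\<nu>A)"
    unfolding C_def by (rule pPA.Fubini_integral[OF corr, symmetric])
  also have "\<dots> = (\<integral>t. 0 \<partial>\<nu>A)"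
  proof (rule Bochner_Integration.integral_cong[OF refl])
    fix t assume "t \<in> space \<nu>A"
    then have "t \<in> \<A>" by (simp only: space_\<nu>A)
    \<comment> \<open>\<open>PL\<close> has mass one, so the constant \<open>m' t\<close> integrates
      to itself and offsets the mean of \<open>\<mu>'\<close>.\<close>
    then show "(\<integral>l. (\<mu>' l t - m' t) * W' t \<partial>PL) = 0"
      using integrable_\<mu>' by (simp add: m'_def PL.prob_space)
  qed
  finally have "(\<integral>l. C l \<partial>PL) = 0" by simp
  with C have intC: "integrable M (\<lambda>\<omega>. C (L \<omega>))" "expectation (\<lambda>\<omega>. C (L \<omega>)) = 0"
    using integrable_distr_eq[OF L_meas, of C] integral_distr[OF L_meas, of C] by (auto simp: L_PL)

  have \<phi>_eq: "\<phi> PL \<A> \<pi>' \<mu>' \<psi> (l, a, y) = \<xi> PL \<pi>' \<mu>' (l, a, y) - \<psi> + C l" for l a y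
    using borel_supports
    by (simp add: \<phi>_def C_def m'_def W'_def integral_restrict_space set_lebesgue_integral_def)
  \<comment> \<open>Integrability of \<xi> under the joint law is recovered from that of \<phi>: the
    two differ by a constant and the integrable \<open>C (L \<omega>)\<close>.\<close>
  have "integrable M (\<lambda>\<omega>. \<phi> PL \<A> \<pi>' \<mu>' \<psi> (L \<omega>, A \<omega>, Y \<omega>) + \<psi> - C (L \<omega>))"
    using integrable_\<phi> intC by simp
  then have \<xi>M: "integrable M (\<lambda>\<omega>. \<xi> PL \<pi>' \<mu>' (L \<omega>, A \<omega>, Y \<omega>))"
    by (simp add: \<phi>_eq)

  \<comment> \<open>Expectation of \<xi> under the joint law\<close>
  let ?N = "\<nu>L \<Otimes>\<^sub>M (\<nu>A \<Otimes>\<^sub>M \<nu>Y)"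
  let ?p = "\<lambda>(l, a, y). pY y l a * \<pi> a l * pL l"
  have dist: "distributed M ?N (\<lambda>\<omega>. (L \<omega>, A \<omega>, Y \<omega>)) (\<lambda>x. ennreal (?p x))"
    using joint_density by (simp add: prod.case_distrib[of ennreal])
  have p_nonneg: "0 \<le> ?p x" if "x \<in> space ?N" for x
    using that nonneg_pL nonneg_pY nonneg_\<pi> by (auto simp: space_pair_measure space_\<nu>L space_\<nu>A space_\<nu>Y)
  \<comment> \<open>Measurability of a parametric integral expects the integrated coordinate second,
    hence the swapped pairs.\<close>
  have [measurable]: "(\<lambda>a. \<integral>l. \<pi>' a l \<partial>PL) \<in> borel_measurable \<nu>A"
      "(\<lambda>a. \<integral>l. \<mu>' l a \<partial>PL) \<in> borel_measurable \<nu>A"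
    using measurable_pair_swap[OF measurable_\<pi>'] measurable_pair_swap[OF measurable_\<mu>']
    by (intro PL.borel_measurable_lebesgue_integral; simp)+
  have [measurable]: "(\<lambda>y. y) \<in> borel_measurable \<nu>Y"
    by (simp add: measurable_cong_sets[OF dominating_Y(2) refl] measurable_restrict_space1)
  have \<xi>_meas: "\<xi> PL \<pi>' \<mu>' \<in> borel_measurable ?N"
  proof -
    have [measurable]: "(\<lambda>x. \<pi>' (fst (snd x)) (fst x)) \<in> borel_measurable ?N"
        "(\<lambda>x. \<mu>' (fst x) (fst (snd x))) \<in> borel_measurable ?N"
      using measurable_compose[of "\<lambda>x. (fst x, fst (snd x))" ?N "\<nu>L \<Otimes>\<^sub>M \<nu>A" "\<lambda>p. \<pi>' (snd p) (fst p)" borel]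
        measurable_compose[of "\<lambda>x. (fst x, fst (snd x))" ?N "\<nu>L \<Otimes>\<^sub>M \<nu>A" "\<lambda>p. \<mu>' (fst p) (snd p)" borel]
      by simp_all
    show ?thesis
      unfolding \<xi>_def case_prod_beta by measurable
  qed
  have "expectation (\<lambda>\<omega>. \<xi> PL \<pi>' \<mu>' (L \<omega>, A \<omega>, Y \<omega>)) = (\<integral>x. ?p x * \<xi> PL \<pi>' \<mu>' x \<partial>?N)"
    by (rule distributed_integral[OF dist \<xi>_meas p_nonneg, symmetric])
  \<comment> \<open>With a outermost, each slice is the unnormalised form of the conditional
    computation, with value \<open>\<theta> a * w a\<close>.\<close>
  also have "\<dots> = (\<integral>a. \<integral>l. \<integral>y. ?p (l, a, y) * \<xi> PL \<pi>' \<mu>' (l, a, y) \<partial>\<nu>Y \<partial>\<nu>L \<partial>\<nu>A)"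
    using distributed_integrable[OF dist \<xi>_meas p_nonneg] \<xi>M
    by (intro integral_triple_swap dominating_L dominating_Y sigma_finite_\<nu>A) simp
  also have "\<dots> = (\<integral>a. \<theta> a * w a \<partial>\<nu>A)"
  proof (rule Bochner_Integration.integral_cong[OF refl])
    fix a assume "a \<in> space \<nu>A"
    then have a: "a \<in> \<A>" by (simp only: space_\<nu>A)
    have "(\<integral>l. \<integral>y. ?p (l, a, y) * \<xi> PL \<pi>' \<mu>' (l, a, y) \<partial>\<nu>Y \<partial>\<nu>L)
        = (\<integral>l. \<integral>y. \<xi> PL \<pi>' \<mu>' (l, a, y) * (pY y l a * (\<pi> a l * pL l)) \<partial>\<nu>Y \<partial>\<nu>L)"
      by (simp add: mult_ac)
    also have "\<dots> = (\<integral>l. G l a * (\<pi> a l * pL l) \<partial>\<nu>L)"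
      by (intro Bochner_Integration.integral_cong) (auto simp: space_\<nu>L inner a)
    finally show "(\<integral>l. \<integral>y. ?p (l, a, y) * \<xi> PL \<pi>' \<mu>' (l, a, y) \<partial>\<nu>Y \<partial>\<nu>L) = \<theta> a * w a"
      by (simp add: G\<nu>L a)
  qed
  also have "\<dots> = \<psi>"
    using borel_supports
    by (simp add: \<psi> mean_effect_def \<theta> w integral_restrict_space set_lebesgue_integral_def)
  finally have "expectation (\<lambda>\<omega>. \<xi> PL \<pi>' \<mu>' (L \<omega>, A \<omega>, Y \<omega>)) = \<psi>" .
  then have "expectation (\<lambda>\<omega>. \<phi> PL \<A> \<pi>' \<mu>' \<psi> (L \<omega>, A \<omega>, Y \<omega>)) = 0"
    using \<xi>M intC prob_space by (simp add: \<phi>_eq)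
  with part1 show ?thesis by blast
qed

end
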